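(* Let $n\ge 1$ and let $A:[0,1]^n\to[0,1]$ be $A(x_1,\dots,x_n)=\min(x_1,\dots,x_n)$. Let $T_M(x,y)=\min(x,y)$ on $[0,1]$. A fuzzy subset $\sigma:[0,1]\to[0,1]$ is an $A$-fuzzy $t$-subnorm of $T_M$ if and only if $\sigma(1)=1$.
   Context: For an aggregation operator $A:[0,1]^n\to[0,1]$ (non-decreasing in each argument, $A(0,\dots,0)=0$, $A(1,\dots,1)=1$) and a monoid $(M,\circ)$ with identity $e$, a map $\sigma:M\to[0,1]$ is an $A$-fuzzy submonoid of $M$ if $A(\sigma(x_1),\dots,\sigma(x_n))\le\sigma(x_1\circ\cdots\circ x_n)$ for all $x_1,\dots,x_n\in M$ and $\sigma(e)=1$. For a $t$-norm $T$ (a commutative, associative, coordinatewise non-decreasing operation on $[0,1]$ with identity $1$), an $A$-fuzzy $t$-subnorm of $T$ is an $A$-fuzzy submonoid of the monoid $([0,1],T)$, whose identity is $1$. *)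

theory Defs
  imports Complex_Main "HOL-Algebra.Group"
begin

(* Points of [0,1]^n are lists of length n. *)
definition unit_cube :: "nat \<Rightarrow> real list set" where
  "unit_cube n = {xs. length xs = n \<and> set xs \<subseteq> {0..1}}"

definition aggregation_operator :: "nat \<Rightarrow> (real list \<Rightarrow> real) \<Rightarrow> bool" where
  "aggregation_operator n A \<longleftrightarrow>
     A \<in> unit_cube n \<rightarrow> {0..1} \<and>
     (\<forall>xs \<in> unit_cube n. \<forall>i < n. \<forall>y \<in> {0..1}. xs ! i \<le> y \<longrightarrow> A xs \<le> A (xs[i := y])) \<and>
     A (replicate n 0) = 0 \<and>
     A (replicate n 1) = 1"

definition t_norm :: "(real \<Rightarrow> real \<Rightarrow> real) \<Rightarrow> bool" where
  "t_norm T \<longleftrightarrow>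
     (\<forall>x \<in> {0..1}. \<forall>y \<in> {0..1}. T x y \<in> {0..1}) \<and>
     (\<forall>x \<in> {0..1}. \<forall>y \<in> {0..1}. T x y = T y x) \<and>
     (\<forall>x \<in> {0..1}. \<forall>y \<in> {0..1}. \<forall>z \<in> {0..1}. T (T x y) z = T x (T y z)) \<and>
     (\<forall>x \<in> {0..1}. \<forall>x' \<in> {0..1}. \<forall>y \<in> {0..1}. \<forall>y' \<in> {0..1}.
        x \<le> x' \<longrightarrow> y \<le> y' \<longrightarrow> T x y \<le> T x' y') \<and>
     (\<forall>x \<in> {0..1}. T x 1 = x)"

(* The fold is the ordered product of xs, so no commutativity is presupposed.
   The standing assumptions on A and M are part of the predicate. *)
definition fuzzy_submonoid ::
    "nat \<Rightarrow> (real list \<Rightarrow> real) \<Rightarrow> ('a, 'b) monoid_scheme \<Rightarrow> ('a \<Rightarrow> real) \<Rightarrow> bool" where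
  "fuzzy_submonoid n A M \<sigma> \<longleftrightarrow>
     aggregation_operator n A \<and> monoid M \<and> \<sigma> \<in> carrier M \<rightarrow> {0..1} \<and>
     (\<forall>xs. length xs = n \<longrightarrow> set xs \<subseteq> carrier M \<longrightarrow>
        A (map \<sigma> xs) \<le> \<sigma> (foldr (mult M) xs \<one>\<^bsub>M\<^esub>)) \<and>
     \<sigma> \<one>\<^bsub>M\<^esub> = 1"

definition t_norm_monoid :: "(real \<Rightarrow> real \<Rightarrow> real) \<Rightarrow> real monoid" where
  "t_norm_monoid T = \<lparr>carrier = {0..1}, mult = T, one = 1\<rparr>"

definition fuzzy_t_subnorm ::
    "nat \<Rightarrow> (real list \<Rightarrow> real) \<Rightarrow> (real \<Rightarrow> real \<Rightarrow> real) \<Rightarrow> (real \<Rightarrow> real) \<Rightarrow> bool" where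
  "fuzzy_t_subnorm n A T \<sigma> \<longleftrightarrow> t_norm T \<and> fuzzy_submonoid n A (t_norm_monoid T) \<sigma>"

end

theory Submission
  imports Defs
begin

text \<open>The minimum of finitely many numbers is one of them. So the
  \<open>T\<^sub>M\<close>-product of a nonempty list is an entry of that list
  (\<open>foldr_min_in_set\<close>), and \<sigma> of the product is one of the values whose minimum
  \<open>A\<close> takes; the submonoid inequality follows for every \<sigma>, whatever its shape.
  What remains of the definition is the value 1 at the identity, which is exactly the stated
  condition. Since the predicates also contain the standing assumptions, \<open>Min\<close> has to
  be shown to be an aggregation operator (\<open>aggregation_operator_Min\<close>) and
  \<open>min\<close> a t-norm (\<open>t_norm_min\<close>), whence a monoid on the unit interval
  (\<open>monoid_t_norm_monoid\<close>).\<close>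

lemma Min_set_le_Min_set_list_update:
  fixes xs :: "'a::linorder list"
  assumes "i < length xs" and "xs ! i \<le> y"
  shows "Min (set xs) \<le> Min (set (xs[i := y]))"
proof -
  have "Min (set xs) \<le> z" if "z \<in> set (xs[i := y])" for z
  proof -
    \<comment> \<open>An entry of the updated list is either an old one or \<open>y\<close>, and
      \<open>y\<close> lies above the old entry that it replaces.\<close>
    from that consider "z = y" | "z \<in> set xs"
      using set_update_subset_insert by fastforce
    then show ?thesis
    proof cases
      case 1
      have "Min (set xs) \<le> xs ! i"
        using assms(1) by simp
      with assms(2) 1 show ?thesis by simp
    qed simp
  qed
  moreover have "set (xs[i := y]) \<noteq> {}"
    using assms(1) by auto
  ultimately show ?thesis by simp
qed

lemma aggregation_operator_Min:
  assumes "n \<ge> 1" and A: "\<And>xs. xs \<in> unit_cube n \<Longrightarrow> A xs = Min (set xs)"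
  shows "aggregation_operator n A"
  unfolding aggregation_operator_def
proof (intro conjI ballI allI impI)
  show "A \<in> unit_cube n \<rightarrow> {0..1}"
  proof
    fix xs assume xs: "xs \<in> unit_cube n"
    \<comment> \<open>Here n \<ge> 1 matters: \<open>Min\<close> has a meaningful value only on a
      nonempty set.\<close>
    with assms(1) have "Min (set xs) \<in> set xs"
      by (intro Min_in) (auto simp: unit_cube_def)
    with xs A[OF xs] show "A xs \<in> {0..1}"
      by (auto simp: unit_cube_def)
  qed
next
  fix xs i and y :: real
  assume xs: "xs \<in> unit_cube n" and i: "i < n" and y: "y \<in> {0..1}" "xs ! i \<le> y"
  have "xs[i := y] \<in> unit_cube n"
    using xs y(1) set_update_subset_insert[of xs i y] by (auto simp: unit_cube_def)
  then show "A xs \<le> A (xs[i := y])"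
    using Min_set_le_Min_set_list_update[of i xs y] xs i y(2) A by (simp add: unit_cube_def)
next
  show "A (replicate n 0) = 0" "A (replicate n 1) = 1"
    using assms(1) by (simp_all add: A unit_cube_def set_replicate_conv_if)
qed

lemma t_norm_min:
  assumes "\<And>x y. x \<in> {0..1} \<Longrightarrow> y \<in> {0..1} \<Longrightarrow> T x y = min x y"
  shows "t_norm T"
  unfolding t_norm_def using assms by (auto simp: min_def)

lemma monoid_t_norm_monoid:
  assumes "t_norm T"
  shows "monoid (t_norm_monoid T)"
proof
  fix x y z
  assume "x \<in> carrier (t_norm_monoid T)" "y \<in> carrier (t_norm_monoid T)"
    "z \<in> carrier (t_norm_monoid T)"
  then have "x \<in> {0..1}" "y \<in> {0..1}" "z \<in> {0..1}"
    by (simp_all add: t_norm_monoid_def)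
  with assms have "T (T x y) z = T x (T y z)"
    unfolding t_norm_def by blast
  then show "x \<otimes>\<^bsub>t_norm_monoid T\<^esub> y \<otimes>\<^bsub>t_norm_monoid T\<^esub> z =
      x \<otimes>\<^bsub>t_norm_monoid T\<^esub> (y \<otimes>\<^bsub>t_norm_monoid T\<^esub> z)"
    by (simp add: t_norm_monoid_def)
next
  fix x assume "x \<in> carrier (t_norm_monoid T)"
  then have x: "x \<in> {0..1}" by (simp add: t_norm_monoid_def)
  \<comment> \<open>\<open>t_norm\<close> gives 1 as a right identity only; commutativity,
    instantiated at 1, turns it into a left identity.\<close>
  have "(1::real) \<in> {0..1}" by simp
  with x assms have "T 1 x = T x 1" "T x 1 = x"
    unfolding t_norm_def by blast+
  then show "\<one>\<^bsub>t_norm_monoid T\<^esub> \<otimes>\<^bsub>t_norm_monoid T\<^esub> x = x"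
    and "x \<otimes>\<^bsub>t_norm_monoid T\<^esub> \<one>\<^bsub>t_norm_monoid T\<^esub> = x"
    by (simp_all add: t_norm_monoid_def)
qed (use assms in \<open>simp_all add: t_norm_monoid_def t_norm_def\<close>)

text \<open>The starting value 1 is the top of the interval, so the last entry absorbs it; from then
  on each \<open>min\<close> selects one of its two arguments.\<close>

lemma foldr_min_in_set:
  fixes xs :: "real list"
  assumes T: "\<And>x y. x \<in> {0..1} \<Longrightarrow> y \<in> {0..1} \<Longrightarrow> T x y = min x y"
    and "xs \<noteq> []" and "set xs \<subseteq> {0..1}"
  shows "foldr T xs 1 \<in> set xs"
  using assms(2,3)
proof (induction xs rule: list_nonempty_induct)
  case (single x)
  then show ?case using T[of x 1] by simp
next
  case (cons x xs)
  then have IH: "foldr T xs 1 \<in> set xs" by simp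
  \<comment> \<open>\<open>T\<close> is known to be \<open>min\<close> only on the unit interval, so
    the product of the tail must be placed there before \<open>T\<close> can be rewritten; being an
    entry, it is there.\<close>
  with cons.prems have "foldr T xs 1 \<in> {0..1}" by auto
  with cons.prems have "foldr T (x # xs) 1 = min x (foldr T xs 1)"
    using T by simp
  with IH show ?case by (simp add: min_def)
qed

theorem proposition3p2:
  fixes n :: nat and A :: "real list \<Rightarrow> real" and T\<^sub>M :: "real \<Rightarrow> real \<Rightarrow> real"
    and \<sigma> :: "real \<Rightarrow> real"
  assumes "n \<ge> 1"
    and "\<And>xs. xs \<in> unit_cube n \<Longrightarrow> A xs = Min (set xs)"
    and "\<And>x y. x \<in> {0..1} \<Longrightarrow> y \<in> {0..1} \<Longrightarrow> T\<^sub>M x y = min x y"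
    and "\<sigma> \<in> {0..1} \<rightarrow> {0..1}"
  shows "fuzzy_t_subnorm n A T\<^sub>M \<sigma> \<longleftrightarrow> \<sigma> 1 = 1"
proof
  assume "fuzzy_t_subnorm n A T\<^sub>M \<sigma>"
  then show "\<sigma> 1 = 1"
    by (simp add: fuzzy_t_subnorm_def fuzzy_submonoid_def t_norm_monoid_def)
next
  assume one: "\<sigma> 1 = 1"
  have T: "t_norm T\<^sub>M"
    using assms(3) by (rule t_norm_min)
  have "A (map \<sigma> xs) \<le> \<sigma> (foldr T\<^sub>M xs 1)"
    if xs: "length xs = n" "set xs \<subseteq> {0..1}" for xs
  proof -
    have "map \<sigma> xs \<in> unit_cube n"
      using xs assms(4) by (auto simp: unit_cube_def)
    then have "A (map \<sigma> xs) = Min (\<sigma> ` set xs)"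
      using assms(2) by simp
    also have "\<dots> \<le> \<sigma> (foldr T\<^sub>M xs 1)"
    proof (rule Min_le)
      \<comment> \<open>The empty product would be 1, which is not an entry; n \<ge> 1 excludes
        it.\<close>
      have "xs \<noteq> []" using xs(1) assms(1) by auto
      then have "foldr T\<^sub>M xs 1 \<in> set xs"
        using assms(3) xs(2) by (intro foldr_min_in_set) auto
      then show "\<sigma> (foldr T\<^sub>M xs 1) \<in> \<sigma> ` set xs" by (rule imageI)
    qed simp
    finally show ?thesis .
  qed
  moreover have "aggregation_operator n A"
    using assms(1,2) by (rule aggregation_operator_Min)
  ultimately show "fuzzy_t_subnorm n A T\<^sub>M \<sigma>"
    using T monoid_t_norm_monoid[OF T] assms(4) one
    unfolding fuzzy_t_subnorm_def fuzzy_submonoid_def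
    by (simp add: t_norm_monoid_def)
qed

end
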